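(* Let $f(1+x)=\sum_{k\ge1}c_kx^k$ be an invertible power series, with inverse $f^{-1}(x)=1+\sum_{k\ge1}b_kx^k$, $b_1=1/c_1$. Let $\mathrm g$ be a grading on $\mathbb A^*$ that is preserved by the quasi-shuffle product $*$ on $\mathbb R\langle\mathbb A\rangle$, let $n\in\mathbb N$, and let $\pi_{\mathrm g\le n}$ be the truncation according to this grading. Then, up to higher order terms (i.e. up to an endomorphism that annihilates every word $w$ with $\mathrm g(w)\le n+1$), the map-truncate-invert endomorphism $F^{-1}\circ\pi_{\mathrm g\le n}\circ F^{\star}(\mathrm{id})$ is given by $$\pi_{\mathrm g\le n}+\pi_{\mathrm g=n+1}\circ\Bigl(\mathfrak J-\frac1{c_1}F^{\star}(\mathrm{id})\Bigr).$$
   Context: $\mathbb A$ is an alphabet, $\mathbb A^*$ the set of words over $\mathbb A$ (with empty word $\mathbf 1$), $\mathbb R\langle\mathbb A\rangle$ the real vector space with basis $\mathbb A^*$, $\mathbb{RA}$ the span of the letters. Given a commutative associative product $[\cdot,\cdot]$ on $\mathbb{RA}$, the quasi-shuffle product $*$ on $\mathbb R\langle\mathbb A\rangle$ is the bilinear product with $u*\mathbf 1=\mathbf 1*u=u$ and $ua*vb=(u*vb)a+(ua*v)b+(u*v)[a,b]$ for words $u,v$ and letters $a,b$. The convolution product of linear endomorphisms $X,Y$ of $\mathbb R\langle\mathbb A\rangle$ is $(X\star Y)(w)=\sum_{uv=w}X(u)*Y(v)$, the sum being over all factorizations of the word $w$ by concatenation (including empty factors); its unit $\nu$ fixes $\mathbf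 1$ and sends nonempty words to $0$. $\mathfrak J=\mathrm{id}-\nu$. A grading is a map $\mathrm g:\mathbb A^*\to\mathbb Z_{\ge0}$ that is positive on nonempty words and $0$ on $\mathbf 1$. It is preserved by $*$ if for all words $u,v$ the polynomial $u*v$ is a linear combination of words of grade $\mathrm g(u)+\mathrm g(v)$. $\pi_{\mathrm g\le n}$ (resp. $\pi_{\mathrm g=n+1}$) is the linear projection fixing words of grade $\le n$ (resp. $=n+1$) and sending all other words to $0$. For the power series above, $F^{\star}(\mathrm{id})=\sum_{k\ge1}c_k\mathfrak J^{\star k}$ (a finite sum on each word), and for an endomorphism $X$ with $X(\mathbf 1)=0$, $F^{-1}(X)=\nu+\sum_{k\ge1}b_kX^{\star k}$. The notation $F^{-1}\circ\pi_{\mathrm g\le n}\circ F^{\star}(\mathrm{id})$ means $F^{-1}\bigl(\pi_{\mathrm g\le n}\circ F^{\star}(\mathrm{id})\bigr)$. *)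

theory Defs
  imports "HOL-Analysis.Analysis" "HOL-Analysis.Finite_Function_Topology"
    "HOL-Computational_Algebra.Formal_Power_Series"
begin

text \<open>
  The alphabet is a type \<open>'a\<close>, words are lists, and the real vector spaces with basis the letters
  (resp. the words) are the finitely supported functions \<open>'a \<Rightarrow>\<^sub>0 real\<close> (resp. \<open>'a list \<Rightarrow>\<^sub>0 real\<close>).
\<close>

type_synonym 'a lcomb = "'a \<Rightarrow>\<^sub>0 real"
type_synonym 'a ncpoly = "'a list \<Rightarrow>\<^sub>0 real"

abbreviation basis :: "'b \<Rightarrow> ('b \<Rightarrow>\<^sub>0 real)" where
  "basis x \<equiv> Poly_Mapping.single x 1"

definition lin_ext :: "('b \<Rightarrow> 'c::real_vector) \<Rightarrow> ('b \<Rightarrow>\<^sub>0 real) \<Rightarrow> 'c" where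
  "lin_ext h p = (\<Sum>x\<in>Poly_Mapping.keys p. Poly_Mapping.lookup p x *\<^sub>R h x)"

lemma lookup_scaleR_pm: "Poly_Mapping.lookup (r *\<^sub>R p) x = r *\<^sub>R Poly_Mapping.lookup p x"
proof -
  have "finite {i. r *\<^sub>R Poly_Mapping.lookup p i \<noteq> 0}"
    by (rule finite_subset[of _ "Poly_Mapping.keys p"]) (auto simp: in_keys_iff)
  then show ?thesis
    by (simp add: scaleR_poly_mapping_def)
qed

lemma lin_ext_superset:
  assumes "finite A" "Poly_Mapping.keys p \<subseteq> A"
  shows "lin_ext h p = (\<Sum>x\<in>A. Poly_Mapping.lookup p x *\<^sub>R h x)"
  unfolding lin_ext_def
  by (rule sum.mono_neutral_left) (use assms in \<open>auto simp: in_keys_iff\<close>)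

lemma linear_lin_ext:
  fixes h :: "'b \<Rightarrow> 'c::real_vector"
  shows "linear (lin_ext h)"
proof (rule linearI)
  fix p q :: "'b \<Rightarrow>\<^sub>0 real" and r :: real
  let ?A = "Poly_Mapping.keys p \<union> Poly_Mapping.keys q"
  have "lin_ext h (p + q) = (\<Sum>x\<in>?A. Poly_Mapping.lookup (p + q) x *\<^sub>R h x)"
    by (rule lin_ext_superset) (auto simp: Poly_Mapping.keys_add)
  also have "\<dots> = lin_ext h p + lin_ext h q"
    by (simp add: lin_ext_superset[of ?A] lookup_add scaleR_add_left sum.distrib)
  finally show "lin_ext h (p + q) = lin_ext h p + lin_ext h q" .
  have "lin_ext h (r *\<^sub>R p) = (\<Sum>x\<in>Poly_Mapping.keys p. Poly_Mapping.lookup (r *\<^sub>R p) x *\<^sub>R h x)"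
    by (rule lin_ext_superset) (auto simp: in_keys_iff lookup_scaleR_pm)
  then show "lin_ext h (r *\<^sub>R p) = r *\<^sub>R lin_ext h p"
    by (simp add: lin_ext_def lookup_scaleR_pm scaleR_sum_right)
qed

lemma lin_ext_basis [simp]: "lin_ext h (basis x) = h x"
  by (simp add: lin_ext_def)

definition letters :: "'a lcomb \<Rightarrow> 'a ncpoly" where
  "letters = lin_ext (\<lambda>a. basis [a])"

definition concat_prod :: "'a ncpoly \<Rightarrow> 'a ncpoly \<Rightarrow> 'a ncpoly" where
  "concat_prod p q = lin_ext (\<lambda>u. lin_ext (\<lambda>v. basis (u @ v)) q) p"

definition letter_bracket :: "('a lcomb \<Rightarrow> 'a lcomb \<Rightarrow> 'a lcomb) \<Rightarrow> bool" where
  "letter_bracket br \<longleftrightarrow> bilinear br \<and> (\<forall>x y. br x y = br y x)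
     \<and> (\<forall>x y z. br (br x y) z = br x (br y z))"

function qshuffle_word :: "('a lcomb \<Rightarrow> 'a lcomb \<Rightarrow> 'a lcomb) \<Rightarrow> 'a list \<Rightarrow> 'a list \<Rightarrow> 'a ncpoly" where
  "qshuffle_word br u [] = basis u"
| "qshuffle_word br [] v = basis v"
| "qshuffle_word br (u @ [a]) (v @ [b]) =
     concat_prod (qshuffle_word br u (v @ [b])) (basis [a])
   + concat_prod (qshuffle_word br (u @ [a]) v) (basis [b])
   + concat_prod (qshuffle_word br u v) (letters (br (basis a) (basis b)))"
proof goal_cases
  case (1 P x)
  obtain br u v where x: "x = (br, u, v)" by (cases x) auto
  show ?case
    by (cases u rule: rev_exhaust; cases v rule: rev_exhaust) (use 1 x in auto)
qed auto
termination
  by (relation "Wellfounded.measure (\<lambda>(_, u, v). length u + length v)") auto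

definition qshuffle :: "('a lcomb \<Rightarrow> 'a lcomb \<Rightarrow> 'a lcomb) \<Rightarrow> 'a ncpoly \<Rightarrow> 'a ncpoly \<Rightarrow> 'a ncpoly" where
  "qshuffle br p q = lin_ext (\<lambda>u. lin_ext (\<lambda>v. qshuffle_word br u v) q) p"

lemma qshuffle_basis [simp]: "qshuffle br (basis u) (basis v) = qshuffle_word br u v"
  by (simp add: qshuffle_def)

lemma bilinear_qshuffle: "bilinear (qshuffle br)"
  unfolding bilinear_def
proof (intro conjI allI)
  fix q show "linear (\<lambda>p. qshuffle br p q)"
    unfolding qshuffle_def by (rule linear_lin_ext)
next
  fix p
  have "linear (\<lambda>q. \<Sum>u\<in>Poly_Mapping.keys p.
      Poly_Mapping.lookup p u *\<^sub>R lin_ext (\<lambda>v. qshuffle_word br u v) q)"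
    by (intro linear_compose_sum ballI linear_compose_scale_right linear_lin_ext)
  then show "linear (qshuffle br p)"
    unfolding qshuffle_def lin_ext_def[of _ p] .
qed

definition nu :: "'a ncpoly \<Rightarrow> 'a ncpoly" where
  "nu = lin_ext (\<lambda>w. if w = [] then basis [] else 0)"

definition JJ :: "'a ncpoly \<Rightarrow> 'a ncpoly" where
  "JJ p = p - nu p"

definition conv ::
  "('a lcomb \<Rightarrow> 'a lcomb \<Rightarrow> 'a lcomb) \<Rightarrow> ('a ncpoly \<Rightarrow> 'a ncpoly) \<Rightarrow> ('a ncpoly \<Rightarrow> 'a ncpoly)
     \<Rightarrow> 'a ncpoly \<Rightarrow> 'a ncpoly" where
  "conv br X Y = lin_ext (\<lambda>w. \<Sum>(u, v)\<in>{(u, v). u @ v = w}.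
     qshuffle br (X (basis u)) (Y (basis v)))"

lemma finite_factorizations: "finite {(u, v). u @ v = w}"
proof -
  have "{(u, v). u @ v = w} \<subseteq> (\<lambda>i. (take i w, drop i w)) ` {..length w}"
  proof clarify
    fix u v show "(u, v) \<in> (\<lambda>i. (take i (u @ v), drop i (u @ v))) ` {..length (u @ v)}"
      by (rule image_eqI[of _ _ "length u"]) auto
  qed
  then show ?thesis
    by (rule finite_subset) simp
qed

definition conv_pow ::
  "('a lcomb \<Rightarrow> 'a lcomb \<Rightarrow> 'a lcomb) \<Rightarrow> ('a ncpoly \<Rightarrow> 'a ncpoly) \<Rightarrow> nat \<Rightarrow> 'a ncpoly \<Rightarrow> 'a ncpoly" where
  "conv_pow br X k = (conv br X ^^ k) nu"

lemma conv_pow_eq_0: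
  assumes "X (basis []) = 0" "length w < k"
  shows "conv_pow br X k (basis w) = 0"
  using assms(2)
proof (induction k arbitrary: w)
  case (Suc k)
  have "qshuffle br (X (basis u)) (conv_pow br X k (basis v)) = 0" if "u @ v = w" for u v
  proof (cases "u = []")
    case True
    then show ?thesis
      using assms(1) bilinear_lzero[OF bilinear_qshuffle] by simp
  next
    case False
    then have "0 < length u" by simp
    moreover have "length u + length v < Suc k"
      using that Suc.prems by auto
    ultimately have "length v < k"
      by linarith
    then show ?thesis
      using Suc.IH bilinear_rzero[OF bilinear_qshuffle] by simp
  qed
  then show ?case
    by (auto simp: conv_pow_def conv_def intro!: sum.neutral)
qed simp

text \<open>
  The convolution series \<open>a\<^sub>1 X + a\<^sub>2 X\<^sup>2 + \<dots>\<close>, without constant term. On each word all but finitely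
  many terms vanish when \<open>X\<close> kills the empty word (see \<open>conv_pow_eq_0\<close>), so that \<open>Sum_any\<close>
  is the genuine sum.
\<close>

definition conv_series ::
  "('a lcomb \<Rightarrow> 'a lcomb \<Rightarrow> 'a lcomb) \<Rightarrow> real fps \<Rightarrow> ('a ncpoly \<Rightarrow> 'a ncpoly) \<Rightarrow> 'a ncpoly \<Rightarrow> 'a ncpoly" where
  "conv_series br a X =
     lin_ext (\<lambda>w. Sum_any (\<lambda>k. if 1 \<le> k then fps_nth a k *\<^sub>R conv_pow br X k (basis w) else 0))"

lemma conv_series_basis:
  assumes "X (basis []) = 0"
  shows "conv_series br a X (basis w) =
    (\<Sum>k=1..length w. fps_nth a k *\<^sub>R conv_pow br X k (basis w))"
proof -
  let ?t = "\<lambda>k. if 1 \<le> k then fps_nth a k *\<^sub>R conv_pow br X k (basis w) else 0"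
  have "{k. ?t k \<noteq> 0} \<subseteq> {1..length w}"
    using conv_pow_eq_0[where X = X, OF assms] by (auto split: if_splits intro: ccontr)
  then have "Sum_any ?t = sum ?t {1..length w}"
    by (intro Sum_any.expand_superset) auto
  then show ?thesis
    by (simp add: conv_series_def)
qed

definition F_star_id :: "('a lcomb \<Rightarrow> 'a lcomb \<Rightarrow> 'a lcomb) \<Rightarrow> real fps \<Rightarrow> 'a ncpoly \<Rightarrow> 'a ncpoly" where
  "F_star_id br c = conv_series br c JJ"

definition F_inv ::
  "('a lcomb \<Rightarrow> 'a lcomb \<Rightarrow> 'a lcomb) \<Rightarrow> real fps \<Rightarrow> ('a ncpoly \<Rightarrow> 'a ncpoly) \<Rightarrow> 'a ncpoly \<Rightarrow> 'a ncpoly" where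
  "F_inv br b X p = nu p + conv_series br b X p"

text \<open>
  For \<open>f(1 + x) = c(x)\<close> with \<open>c(0) = 0\<close> and \<open>f\<inverse>(x) = b(x)\<close> with \<open>b(0) = 1\<close>, the two conditions
  \<open>f(f\<inverse>(x)) = x\<close> and \<open>f\<inverse>(f(1 + x)) = 1 + x\<close>.
\<close>

definition inverse_series_at_1 :: "real fps \<Rightarrow> real fps \<Rightarrow> bool" where
  "inverse_series_at_1 c b \<longleftrightarrow> fps_nth c 0 = 0 \<and> fps_nth b 0 = 1
     \<and> fps_compose c (b - 1) = fps_X \<and> fps_compose b c = 1 + fps_X"

lemma inverse_series_at_1_nth_1:
  assumes "inverse_series_at_1 c b"
  shows "fps_nth c 1 \<noteq> 0" "fps_nth b 1 = 1 / fps_nth c 1"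
proof -
  have "fps_nth (fps_compose b c) 1 = 1"
    using assms by (simp add: inverse_series_at_1_def)
  then have "fps_nth b 1 * fps_nth c 1 = 1"
    by (simp add: fps_compose_nth)
  then show "fps_nth c 1 \<noteq> 0" "fps_nth b 1 = 1 / fps_nth c 1"
    by (auto intro: eq_divide_imp)
qed

lemma inverse_series_at_1_exists:
  assumes "fps_nth c 0 = 0" "fps_nth c 1 \<noteq> 0"
  shows "inverse_series_at_1 c (1 + fps_inv c)"
  using fps_inv[OF assms] fps_inv_right[OF assms] assms(1)
  by (simp add: inverse_series_at_1_def fps_compose_add_distrib fps_inv_def)

definition grading :: "('a list \<Rightarrow> nat) \<Rightarrow> bool" where
  "grading g \<longleftrightarrow> g [] = 0 \<and> (\<forall>w. w \<noteq> [] \<longrightarrow> 0 < g w)"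

definition preserved_by_qshuffle ::
  "('a lcomb \<Rightarrow> 'a lcomb \<Rightarrow> 'a lcomb) \<Rightarrow> ('a list \<Rightarrow> nat) \<Rightarrow> bool" where
  "preserved_by_qshuffle br g \<longleftrightarrow>
     (\<forall>u v. \<forall>w\<in>Poly_Mapping.keys (qshuffle br (basis u) (basis v)). g w = g u + g v)"

definition word_proj :: "('a list \<Rightarrow> bool) \<Rightarrow> 'a ncpoly \<Rightarrow> 'a ncpoly" where
  "word_proj P = lin_ext (\<lambda>w. if P w then basis w else 0)"

end

theory Submission
  imports Defs
begin

text \<open>
  Since the coefficient of \<open>uv\<close> in \<open>u * v\<close> is positive (words of maximal length come from the
  shuffle part only), a grading preserved by \<open>*\<close> is additive under concatenation. Hence
  \<open>X = F\<^sup>\<star>(id)\<close> is homogeneous, and truncating \<open>X\<close> amounts to killing the words of grade above \<open>n\<close>.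
  A factorization of a word of grade \<open>n + 1\<close> into at least two nonempty factors only involves
  factors of grade at most \<open>n\<close>; so on words of grade at most \<open>n + 1\<close> the truncation changes only
  the linear term of \<open>F\<inverse>(X) = id\<close>, and only in grade \<open>n + 1\<close>. The identity \<open>F\<inverse>(X) = id\<close> itself is
  the composition of power series, evaluated in the convolution algebra, which is associative
  because \<open>*\<close> is.
\<close>

section \<open>Linear maps on finitely supported functions\<close>

lemma lin_ext_basis_id: "lin_ext basis p = p"
proof (rule poly_mapping_eqI)
  fix k
  have "Poly_Mapping.lookup (lin_ext basis p) k
      = (\<Sum>x\<in>Poly_Mapping.keys p. Poly_Mapping.lookup p x * (if x = k then 1 else 0))"
    by (simp add: lin_ext_def lookup_sum lookup_scaleR_pm lookup_single when_def)
  also have "\<dots> = Poly_Mapping.lookup p k"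
    by (simp add: if_distrib in_keys_iff cong: if_cong)
  finally show "Poly_Mapping.lookup (lin_ext basis p) k = Poly_Mapping.lookup p k" .
qed

lemma linear_lin_ext_eq:
  assumes "linear f"
  shows "f (lin_ext h p) = lin_ext (\<lambda>x. f (h x)) p"
  by (simp add: lin_ext_def linear_sum[OF assms] linear_scale[OF assms])

lemma linear_eq_on_basis:
  assumes "linear f" "linear h" "\<And>w. f (basis w) = h (basis w)"
  shows "f p = h p"
  using linear_lin_ext_eq[OF assms(1), of basis p] linear_lin_ext_eq[OF assms(2), of basis p]
  by (simp add: lin_ext_basis_id assms(3))

lemma lin_ext_in_subspace:
  assumes "subspace S" "\<And>x. x \<in> Poly_Mapping.keys p \<Longrightarrow> h x \<in> S"
  shows "lin_ext h p \<in> S"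
  unfolding lin_ext_def by (intro subspace_sum subspace_scale assms)

text \<open>Casting support conditions as subspace membership lets homogeneity pass through
  \<open>lin_ext\<close>, finite sums and scalings by closure alone.\<close>

lemma subspace_keys_subset: "subspace {p :: 'b \<Rightarrow>\<^sub>0 real. Poly_Mapping.keys p \<subseteq> A}"
  unfolding subspace_def
  by (auto simp: in_keys_iff lookup_scaleR_pm lookup_add subset_iff) (metis add.right_neutral)

lemma linear_word_proj: "linear (word_proj P)"
  unfolding word_proj_def by (rule linear_lin_ext)

lemma word_proj_basis [simp]: "word_proj P (basis w) = (if P w then basis w else 0)"
  by (simp add: word_proj_def)

lemma word_proj_id:
  assumes "\<And>w. w \<in> Poly_Mapping.keys p \<Longrightarrow> P w"
  shows "word_proj P p = p"
proof -
  have "word_proj P p = lin_ext basis p"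
    unfolding word_proj_def lin_ext_def using assms by (intro sum.cong) auto
  then show ?thesis by (simp add: lin_ext_basis_id)
qed

lemma word_proj_zero:
  assumes "\<And>w. w \<in> Poly_Mapping.keys p \<Longrightarrow> \<not> P w"
  shows "word_proj P p = 0"
  unfolding word_proj_def lin_ext_def using assms by (intro sum.neutral) auto

section \<open>Associativity of the quasi-shuffle product\<close>

lemma bilinear_concat_prod: "bilinear concat_prod"
  unfolding bilinear_def
proof (intro conjI allI)
  fix q show "linear (\<lambda>p. concat_prod p q)"
    unfolding concat_prod_def by (rule linear_lin_ext)
next
  fix p :: "'a ncpoly"
  have "linear (\<lambda>q. \<Sum>u\<in>Poly_Mapping.keys p.
      Poly_Mapping.lookup p u *\<^sub>R lin_ext (\<lambda>v. basis (u @ v)) q :: 'a ncpoly)"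
    by (intro linear_compose_sum ballI linear_compose_scale_right linear_lin_ext)
  then show "linear (concat_prod p)"
    unfolding concat_prod_def lin_ext_def[of _ p] .
qed

lemma linear_letters: "linear letters"
  unfolding letters_def by (rule linear_lin_ext)

lemma letters_basis [simp]: "letters (basis a) = basis [a]"
  by (simp add: letters_def)

text \<open>Treats appending a letter and appending a bracket \<open>br x y\<close> uniformly, so
  that the quasi-shuffle recursion becomes an identity between multilinear expressions.\<close>

definition append_letters :: "'a ncpoly \<Rightarrow> 'a lcomb \<Rightarrow> 'a ncpoly" where
  "append_letters p x = concat_prod p (letters x)"

lemma append_letters_basis [simp]: "append_letters (basis u) (basis a) = basis (u @ [a])"
  by (simp add: append_letters_def concat_prod_def)

lemma bilinear_append_letters: "bilinear append_letters"
  unfolding bilinear_def append_letters_def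
  using bilinear_concat_prod linear_letters
  by (auto simp: bilinear_def intro: linear_compose[unfolded o_def])

lemma qshuffle_word_snoc:
  "qshuffle_word br (u @ [a]) (v @ [b]) =
     append_letters (qshuffle_word br u (v @ [b])) (basis a)
   + append_letters (qshuffle_word br (u @ [a]) v) (basis b)
   + append_letters (qshuffle_word br u v) (br (basis a) (basis b))"
  by (simp add: append_letters_def)

lemmas bilinear_simps =
  bilinear_ladd bilinear_radd bilinear_lmul bilinear_rmul

lemmas qshuffle_simps = bilinear_simps[OF bilinear_qshuffle]
lemmas append_letters_simps = bilinear_simps[OF bilinear_append_letters]

text \<open>The defining recursion extends from words and letters by linearity, one argument at a
  time. Associativity needs this generality: a first expansion already produces polynomials as
  factors and brackets in place of last letters.\<close>

lemma qshuffle_append_letters: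
  assumes "bilinear br"
  shows "qshuffle br (append_letters p x) (append_letters q y) =
     append_letters (qshuffle br p (append_letters q y)) x
   + append_letters (qshuffle br (append_letters p x) q) y
   + append_letters (qshuffle br p q) (br x y)"
proof -
  note [simp] = qshuffle_simps append_letters_simps bilinear_simps[OF assms]
  let ?L = "\<lambda>p x q y. qshuffle br (append_letters p x) (append_letters q y)"
  let ?R = "\<lambda>p x q y. append_letters (qshuffle br p (append_letters q y)) x
     + append_letters (qshuffle br (append_letters p x) q) y
     + append_letters (qshuffle br p q) (br x y)"
  have 1: "?L (basis u) (basis a) (basis v) (basis b) = ?R (basis u) (basis a) (basis v) (basis b)"
    for u v :: "'a list" and a b
    by (simp add: qshuffle_word_snoc del: qshuffle_word.simps)
  have 2: "?L (basis u) (basis a) (basis v) y = ?R (basis u) (basis a) (basis v) y" for u v a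
    by (rule linear_eq_on_basis[where f = "\<lambda>y. ?L (basis u) (basis a) (basis v) y" and h = "\<lambda>y. ?R (basis u) (basis a) (basis v) y" and p = y])
      (rule 1 | (rule linearI; simp add: algebra_simps))+
  have 3: "?L (basis u) (basis a) q y = ?R (basis u) (basis a) q y" for u a
    by (rule linear_eq_on_basis[where f = "\<lambda>q. ?L (basis u) (basis a) q y" and h = "\<lambda>q. ?R (basis u) (basis a) q y" and p = q])
      (rule 2 | (rule linearI; simp add: algebra_simps))+
  have 4: "?L (basis u) x q y = ?R (basis u) x q y" for u
    by (rule linear_eq_on_basis[where f = "\<lambda>x. ?L (basis u) x q y" and h = "\<lambda>x. ?R (basis u) x q y" and p = x])
      (rule 3 | (rule linearI; simp add: algebra_simps))+
  show ?thesis
    by (rule linear_eq_on_basis[where f = "\<lambda>p. ?L p x q y" and h = "\<lambda>p. ?R p x q y" and p = p])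
      (rule 4 | (rule linearI; simp add: algebra_simps))+
qed

lemma qshuffle_Nil_right [simp]: "qshuffle br p (basis []) = p"
  by (simp add: qshuffle_def lin_ext_basis_id)

lemma qshuffle_word_Nil_left [simp]: "qshuffle_word br [] v = basis v"
  by (cases v rule: rev_cases) auto

lemma qshuffle_Nil_left [simp]: "qshuffle br (basis []) p = p"
proof -
  have "qshuffle_word br [] = basis" by auto
  then show ?thesis by (simp add: qshuffle_def lin_ext_basis_id)
qed

text \<open>Induction on the total length. Expanding either side twice gives seven terms, one for
  each nonempty set of last letters merged at the end. They match by the induction hypothesis, and
  the term merging all three letters also uses associativity of \<open>br\<close>.\<close>

lemma qshuffle_assoc_basis:
  assumes "bilinear br" and assoc: "\<And>x y z. br (br x y) z = br x (br y z)"
  shows "qshuffle br (qshuffle br (basis u) (basis v)) (basis w)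
    = qshuffle br (basis u) (qshuffle br (basis v) (basis w))"
proof (induction "length u + length v + length w" arbitrary: u v w rule: less_induct)
  case less
  show ?case
  proof (cases "u = [] \<or> v = [] \<or> w = []")
    case True
    then show ?thesis
      by (auto simp del: qshuffle_basis)
  next
    case False
    then obtain u' a v' b w' c where uvw: "u = u' @ [a]" "v = v' @ [b]" "w = w' @ [c]"
      by (metis rev_exhaust)
    define U where "U = basis u'"
    define V where "V = basis v'"
    define W where "W = basis w'"
    define A where "A = basis a"
    define B where "B = basis b"
    define C where "C = basis c"
    note defs = U_def V_def W_def A_def B_def C_def
    have snoc: "basis u = append_letters U A" "basis v = append_letters V B"
        "basis w = append_letters W C"
      by (simp_all add: uvw defs)
    let ?q = "qshuffle br" and ?r = append_letters
    have IH: "?q (?q (basis x) (basis y)) (basis z) = ?q (basis x) (?q (basis y) (basis z))"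
      if "length x + length y + length z < length u + length v + length w" for x y z
      using less that by blast
    \<comment> \<open>One instance for each nonempty choice of last letters to strip; every one
      lowers the total length.\<close>
    have ih:
      "?q (?q U V) W = ?q U (?q V W)"
      "?q (?q U V) (?r W C) = ?q U (?q V (?r W C))"
      "?q (?q U (?r V B)) W = ?q U (?q (?r V B) W)"
      "?q (?q (?r U A) V) W = ?q (?r U A) (?q V W)"
      "?q (?q U (?r V B)) (?r W C) = ?q U (?q (?r V B) (?r W C))"
      "?q (?q (?r U A) V) (?r W C) = ?q (?r U A) (?q V (?r W C))"
      "?q (?q (?r U A) (?r V B)) W = ?q (?r U A) (?q (?r V B) W)"
      unfolding snoc[symmetric] unfolding U_def V_def W_def by (rule IH; simp add: uvw)+
    note exp = qshuffle_append_letters[OF assms(1)]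
    have "?q (?q (?r U A) (?r V B)) (?r W C)
      = ?q (?r (?q U (?r V B)) A + ?r (?q (?r U A) V) B + ?r (?q U V) (br A B)) (?r W C)"
      by (simp only: exp)
    also have "\<dots> = ?r (?q (?q U (?r V B)) (?r W C)) A + ?r (?q (?q U (?r V B)) W) (br A C)
        + ?r (?q (?q (?r U A) V) (?r W C)) B + ?r (?q (?q (?r U A) V) W) (br B C)
        + ?r (?q (?q U V) (?r W C)) (br A B) + ?r (?q (?q U V) W) (br (br A B) C)
        + ?r (?q (?r (?q U (?r V B)) A + ?r (?q (?r U A) V) B + ?r (?q U V) (br A B)) W) C"
      by (simp add: exp[of _ _ W C] qshuffle_simps append_letters_simps)
    \<comment> \<open>The three contributions ending in \<open>C\<close> were kept under one
      \<open>append_letters\<close>; folding them back gives the product of \<open>u\<close> and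
      \<open>v\<close>, to which the last instance of \<open>ih\<close> applies.\<close>
    also have "?r (?q U (?r V B)) A + ?r (?q (?r U A) V) B + ?r (?q U V) (br A B)
        = ?q (?r U A) (?r V B)"
      by (simp only: exp)
    finally have left: "?q (?q (?r U A) (?r V B)) (?r W C)
      = ?r (?q (?q U (?r V B)) (?r W C)) A + ?r (?q (?q U (?r V B)) W) (br A C)
        + ?r (?q (?q (?r U A) V) (?r W C)) B + ?r (?q (?q (?r U A) V) W) (br B C)
        + ?r (?q (?q U V) (?r W C)) (br A B) + ?r (?q (?q U V) W) (br (br A B) C)
        + ?r (?q (?q (?r U A) (?r V B)) W) C" .
    have "?q (?r U A) (?q (?r V B) (?r W C))
      = ?q (?r U A) (?r (?q V (?r W C)) B + ?r (?q (?r V B) W) C + ?r (?q V W) (br B C))"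
      by (simp only: exp)
    also have "\<dots> = ?r (?q U (?r (?q V (?r W C)) B + ?r (?q (?r V B) W) C + ?r (?q V W) (br B C))) A
        + ?r (?q U (?q (?r V B) W)) (br A C)
        + ?r (?q (?r U A) (?q V (?r W C))) B + ?r (?q (?r U A) (?q V W)) (br B C)
        + ?r (?q U (?q V (?r W C))) (br A B) + ?r (?q U (?q V W)) (br A (br B C))
        + ?r (?q (?r U A) (?q (?r V B) W)) C"
      by (simp add: exp[of U A] qshuffle_simps append_letters_simps)
    \<comment> \<open>Symmetrically, the contributions ending in \<open>A\<close> fold back into the
      product of \<open>v\<close> and \<open>w\<close>.\<close>
    also have "?r (?q V (?r W C)) B + ?r (?q (?r V B) W) C + ?r (?q V W) (br B C)
        = ?q (?r V B) (?r W C)"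
      by (simp only: exp)
    finally show ?thesis
      unfolding snoc by (simp only: left ih assoc)
  qed
qed

lemma qshuffle_assoc:
  assumes "bilinear br" "\<And>x y z. br (br x y) z = br x (br y z)"
  shows "qshuffle br (qshuffle br p q) r = qshuffle br p (qshuffle br q r)"
proof -
  note [simp] = qshuffle_simps
  note 1 = qshuffle_assoc_basis[OF assms]
  have 2: "qshuffle br (qshuffle br (basis u) (basis v)) r
      = qshuffle br (basis u) (qshuffle br (basis v) r)" for u v
    by (rule linear_eq_on_basis[where f = "\<lambda>r. qshuffle br (qshuffle br (basis u) (basis v)) r" and h = "\<lambda>r. qshuffle br (basis u) (qshuffle br (basis v) r)" and p = r])
      (rule 1 | (rule linearI; simp del: qshuffle_basis))+
  have 3: "qshuffle br (qshuffle br (basis u) q) r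
      = qshuffle br (basis u) (qshuffle br q r)" for u
    by (rule linear_eq_on_basis[where f = "\<lambda>q. qshuffle br (qshuffle br (basis u) q) r" and h = "\<lambda>q. qshuffle br (basis u) (qshuffle br q r)" and p = q])
      (rule 2 | (rule linearI; simp))+
  show ?thesis
    by (rule linear_eq_on_basis[where f = "\<lambda>p. qshuffle br (qshuffle br p q) r" and h = "\<lambda>p. qshuffle br p (qshuffle br q r)" and p = p])
      (rule 3 | (rule linearI; simp))+
qed

section \<open>Gradings preserved by the quasi-shuffle product\<close>

text \<open>A nonempty word splits uniquely into its \<open>butlast\<close> and its last letter.
  This turns the recursion into one for coefficients.\<close>

lemma lookup_append_letters:
  "Poly_Mapping.lookup (append_letters p x) w =
    (if w = [] then 0 else Poly_Mapping.lookup p (butlast w) * Poly_Mapping.lookup x (last w))"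
proof -
  let ?R = "\<lambda>p x. if w = [] then 0
    else Poly_Mapping.lookup p (butlast w) * Poly_Mapping.lookup x (last w)"
  note [simp] = append_letters_simps
  have 1: "Poly_Mapping.lookup (append_letters (basis u) (basis a)) w = ?R (basis u) (basis a)" for u a
    by (cases w rule: rev_cases) (auto simp: lookup_single when_def)
  have 2: "Poly_Mapping.lookup (append_letters (basis u) x) w = ?R (basis u) x" for u
    by (rule linear_eq_on_basis[where f = "\<lambda>x. Poly_Mapping.lookup (append_letters (basis u) x) w" and h = "\<lambda>x. ?R (basis u) x" and p = x])
      (rule 1 | (rule linearI; simp add: lookup_add lookup_scaleR_pm algebra_simps))+
  show ?thesis
    by (rule linear_eq_on_basis[where f = "\<lambda>p. Poly_Mapping.lookup (append_letters p x) w" and h = "\<lambda>p. ?R p x" and p = p])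
      (rule 2 | (rule linearI; simp add: lookup_add lookup_scaleR_pm algebra_simps))+
qed

text \<open>Each step of the recursion appends one letter while consuming one or, in the bracket
  term, two.\<close>

lemma lookup_qshuffle_word_long:
  assumes "length u + length v < length w"
  shows "Poly_Mapping.lookup (qshuffle_word br u v) w = 0"
  using assms
proof (induction br u v arbitrary: w rule: qshuffle_word.induct)
  case (3 br u a v b)
  then show ?case
    by (simp add: qshuffle_word_snoc lookup_append_letters lookup_add del: qshuffle_word.simps)
qed (auto simp: lookup_single when_def)

text \<open>Negative coefficients can only enter through \<open>br\<close>, and the bracket term is
  too short to reach maximal length.\<close>

lemma lookup_qshuffle_word_max_length_nonneg:
  assumes "length w = length u + length v"
  shows "0 \<le> Poly_Mapping.lookup (qshuffle_word br u v) w"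
  using assms
proof (induction br u v arbitrary: w rule: qshuffle_word.induct)
  case (3 br u a v b)
  have "0 \<le> Poly_Mapping.lookup (qshuffle_word br u (v @ [b])) (butlast w)"
    "0 \<le> Poly_Mapping.lookup (qshuffle_word br (u @ [a]) v) (butlast w)"
    using 3 by simp_all
  moreover have "Poly_Mapping.lookup (qshuffle_word br u v) (butlast w) = 0"
    using 3 by (intro lookup_qshuffle_word_long) simp
  ultimately show ?case
    by (simp add: qshuffle_word_snoc lookup_append_letters lookup_add lookup_single when_def
        del: qshuffle_word.simps)
qed (auto simp: lookup_single when_def)

text \<open>The term appending \<open>b\<close> contributes positively by induction; the term
  appending \<open>a\<close> contributes only if \<open>a = b\<close>, and then nonnegatively; the
  bracket term vanishes for reasons of length.\<close>

lemma lookup_qshuffle_word_concat: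
  "0 < Poly_Mapping.lookup (qshuffle_word br u v) (u @ v)"
proof (induction br u v rule: qshuffle_word.induct)
  case (3 br u a v b)
  have "0 \<le> Poly_Mapping.lookup (qshuffle_word br u (v @ [b])) (u @ a # v)"
    by (intro lookup_qshuffle_word_max_length_nonneg) simp
  moreover have "Poly_Mapping.lookup (qshuffle_word br u v) (u @ a # v) = 0"
    by (intro lookup_qshuffle_word_long) simp
  moreover have "butlast (u @ a # v @ [b]) = u @ a # v"
    by (simp add: butlast_append)
  ultimately show ?case
    using 3 by (auto simp: qshuffle_word_snoc lookup_append_letters lookup_add lookup_single when_def
        simp del: qshuffle_word.simps)
qed auto

lemma preserved_by_qshuffle_append:
  assumes "preserved_by_qshuffle br g"
  shows "g (u @ v) = g u + g v"
proof -
  have "u @ v \<in> Poly_Mapping.keys (qshuffle br (basis u) (basis v))"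
    using lookup_qshuffle_word_concat[of br u v] by (simp add: in_keys_iff)
  then show ?thesis
    using assms by (auto simp: preserved_by_qshuffle_def)
qed

lemma keys_qshuffle_grade:
  assumes "preserved_by_qshuffle br g"
    and "\<forall>u\<in>Poly_Mapping.keys p. g u = i" "\<forall>v\<in>Poly_Mapping.keys q. g v = j"
  shows "\<forall>w\<in>Poly_Mapping.keys (qshuffle br p q). g w = i + j"
proof -
  let ?S = "{p. Poly_Mapping.keys p \<subseteq> {w. g w = i + j}}"
  have "qshuffle_word br u v \<in> ?S"
    if "u \<in> Poly_Mapping.keys p" "v \<in> Poly_Mapping.keys q" for u v
    using assms that by (auto simp: preserved_by_qshuffle_def)
  then have "qshuffle br p q \<in> ?S"
    unfolding qshuffle_def by (intro lin_ext_in_subspace subspace_keys_subset)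
  then show ?thesis by auto
qed

section \<open>The convolution algebra\<close>

lemma linear_conv: "linear (conv br X Y)"
  unfolding conv_def by (rule linear_lin_ext)

lemma linear_nu: "linear nu"
  unfolding nu_def by (rule linear_lin_ext)

lemma nu_basis [simp]: "nu (basis w) = (if w = [] then basis [] else 0)"
  by (simp add: nu_def)

lemma JJ_basis [simp]: "JJ (basis w) = (if w = [] then 0 else basis w)"
  by (simp add: JJ_def)

lemma linear_JJ: "linear JJ"
  using linear_compose_sub[OF linear_id linear_nu] unfolding JJ_def[abs_def] by (simp add: id_def)

lemma linear_conv_series: "linear (conv_series br a X)"
  unfolding conv_series_def by (rule linear_lin_ext)

lemma conv_basis:
  "conv br X Y (basis w) =
    (\<Sum>(u, v)\<in>{(u, v). u @ v = w}. qshuffle br (X (basis u)) (Y (basis v)))"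
  by (simp add: conv_def)

lemma conv_cong:
  assumes "\<And>u v. u @ v = w \<Longrightarrow>
    qshuffle br (X (basis u)) (Y (basis v)) = qshuffle br (X' (basis u)) (Y' (basis v))"
  shows "conv br X Y (basis w) = conv br X' Y' (basis w)"
  unfolding conv_basis using assms by (intro sum.cong) auto

lemma conv_nu_left:
  assumes "linear Y"
  shows "conv br nu Y = Y"
proof
  fix p show "conv br nu Y p = Y p"
  proof (rule linear_eq_on_basis[OF linear_conv assms])
    fix w
    have "conv br nu Y (basis w) = (\<Sum>(u, v)\<in>{([], w)}. qshuffle br (nu (basis u)) (Y (basis v)))"
      unfolding conv_basis
      by (intro sum.mono_neutral_right finite_factorizations)
        (auto simp: bilinear_lzero[OF bilinear_qshuffle] split: if_splits)
    then show "conv br nu Y (basis w) = Y (basis w)" by simp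
  qed
qed

lemma conv_nu_right:
  assumes "linear X"
  shows "conv br X nu = X"
proof
  fix p show "conv br X nu p = X p"
  proof (rule linear_eq_on_basis[OF linear_conv assms])
    fix w
    have "conv br X nu (basis w) = (\<Sum>(u, v)\<in>{(w, [])}. qshuffle br (X (basis u)) (nu (basis v)))"
      unfolding conv_basis
      by (intro sum.mono_neutral_right finite_factorizations)
        (auto simp: bilinear_rzero[OF bilinear_qshuffle] split: if_splits)
    then show "conv br X nu (basis w) = X (basis w)" by simp
  qed
qed

lemma conv_assoc:
  assumes "bilinear br" "\<And>x y z. br (br x y) z = br x (br y z)"
  shows "conv br (conv br X Y) Z = conv br X (conv br Y Z)"
proof
  fix p
  let ?fac = "\<lambda>w :: 'a list. {(u, v). u @ v = w}"
  let ?t = "\<lambda>u v z. qshuffle br (X (basis u)) (qshuffle br (Y (basis v)) (Z (basis z)))"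
  show "conv br (conv br X Y) Z p = conv br X (conv br Y Z) p"
  proof (rule linear_eq_on_basis[OF linear_conv linear_conv])
    fix w
    have lin: "linear (\<lambda>x. qshuffle br x y)" "linear (qshuffle br y)" for y
      using bilinear_qshuffle[of br] by (auto simp: bilinear_def)
    have "conv br (conv br X Y) Z (basis w)
        = (\<Sum>x\<in>?fac w. \<Sum>y\<in>?fac (fst x). ?t (fst y) (snd y) (snd x))"
      unfolding conv_basis
      by (intro sum.cong) (auto simp: linear_sum[OF lin(1)] qshuffle_assoc[OF assms] split_def)
    also have "\<dots> = (\<Sum>(x, y)\<in>(SIGMA x:?fac w. ?fac (fst x)). ?t (fst y) (snd y) (snd x))"
      by (intro sum.Sigma ballI finite_factorizations)
    \<comment> \<open>Both index sets encode the factorizations of \<open>w\<close> into three words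
      \<open>u\<close>, \<open>v\<close>, \<open>z\<close>; the witnesses merely rebracket
      them.\<close>
    also have "\<dots> = (\<Sum>(x, y)\<in>(SIGMA x:?fac w. ?fac (snd x)). ?t (fst x) (fst y) (snd y))"
      by (rule sum.reindex_bij_witness[where i = "\<lambda>((u, vz), (v, z)). ((u @ v, z), (u, v))"
            and j = "\<lambda>((uv, z), (u, v)). ((u, v @ z), (v, z))"]) auto
    also have "\<dots> = (\<Sum>x\<in>?fac w. \<Sum>y\<in>?fac (snd x). ?t (fst x) (fst y) (snd y))"
      by (intro sum.Sigma[symmetric] ballI finite_factorizations)
    also have "\<dots> = conv br X (conv br Y Z) (basis w)"
      unfolding conv_basis
      by (intro sum.cong) (auto simp: linear_sum[OF lin(2)] split_def)
    finally show "conv br (conv br X Y) Z (basis w) = conv br X (conv br Y Z) (basis w)" .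
  qed
qed

lemma conv_pow_0 [simp]: "conv_pow br X 0 = nu"
  by (simp add: conv_pow_def)

lemma conv_pow_Suc: "conv_pow br X (Suc k) = conv br X (conv_pow br X k)"
  by (simp add: conv_pow_def)

lemma linear_conv_pow: "linear (conv_pow br X k)"
  by (cases k) (simp_all add: linear_nu conv_pow_Suc linear_conv)

lemma conv_pow_1:
  assumes "linear X"
  shows "conv_pow br X 1 = X"
  using conv_nu_right[OF assms] by (simp add: conv_pow_Suc)

lemma conv_pow_add:
  assumes "bilinear br" "\<And>x y z. br (br x y) z = br x (br y z)"
  shows "conv br (conv_pow br X i) (conv_pow br X j) = conv_pow br X (i + j)"
  by (induction i)
    (simp_all add: conv_nu_left linear_conv_pow conv_pow_Suc conv_assoc[OF assms])

section \<open>Power series in the convolution algebra\<close>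

text \<open>Evaluation of a power series at \<open>JJ\<close>. Unlike \<open>conv_series\<close> it
  keeps the constant term, as a multiple of the unit \<open>nu\<close>, so that it respects
  products; cutting at \<open>length w\<close> loses nothing since \<open>JJ\<close> kills the empty
  word.\<close>

definition fps_conv :: "('a lcomb \<Rightarrow> 'a lcomb \<Rightarrow> 'a lcomb) \<Rightarrow> real fps \<Rightarrow> 'a ncpoly \<Rightarrow> 'a ncpoly" where
  "fps_conv br a = lin_ext (\<lambda>w. \<Sum>k\<le>length w. fps_nth a k *\<^sub>R conv_pow br JJ k (basis w))"

lemma linear_fps_conv: "linear (fps_conv br a)"
  unfolding fps_conv_def by (rule linear_lin_ext)

text \<open>The free bound \<open>N\<close> allows all factors of a word to be expanded with the
  length of the whole word as common bound.\<close>

lemma fps_conv_basis: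
  assumes "length w \<le> N"
  shows "fps_conv br a (basis w) = (\<Sum>k\<le>N. fps_nth a k *\<^sub>R conv_pow br JJ k (basis w))"
  unfolding fps_conv_def lin_ext_basis
  by (intro sum.mono_neutral_left) (use assms in \<open>auto simp: conv_pow_eq_0\<close>)

lemma fps_conv_1: "fps_conv br 1 = nu"
proof
  fix p show "fps_conv br 1 p = nu p"
    by (rule linear_eq_on_basis[OF linear_fps_conv linear_nu])
      (simp add: fps_conv_basis[OF order_refl] if_distrib[of "\<lambda>x. x *\<^sub>R _"] cong: if_cong)
qed

text \<open>Exponents of \<open>JJ\<close> add under convolution, so the double sum regroups into
  the coefficients of the Cauchy product.\<close>

lemma fps_conv_mult:
  fixes br :: "'a lcomb \<Rightarrow> 'a lcomb \<Rightarrow> 'a lcomb"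
  assumes "bilinear br" "\<And>x y z. br (br x y) z = br x (br y z)"
  shows "conv br (fps_conv br a) (fps_conv br b) = fps_conv br (a * b)"
proof
  fix p show "conv br (fps_conv br a) (fps_conv br b) p = fps_conv br (a * b) p"
  proof (rule linear_eq_on_basis[OF linear_conv linear_fps_conv])
    fix w :: "'a list"
    let ?N = "length w"
    let ?J = "conv_pow br JJ"
    have lin: "linear (\<lambda>x. qshuffle br x y)" "linear (qshuffle br y)" for y
      using bilinear_qshuffle[of br] by (auto simp: bilinear_def)
    have vanish: "k \<le> ?N" if "?J k (basis w) \<noteq> 0" for k
      using that conv_pow_eq_0[of JJ w k br] by (auto simp: not_less[symmetric])
    have "conv br (fps_conv br a) (fps_conv br b) (basis w)
      = (\<Sum>(u, v)\<in>{(u, v). u @ v = w}. \<Sum>i\<le>?N. \<Sum>j\<le>?N.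
          (fps_nth a i * fps_nth b j) *\<^sub>R qshuffle br (?J i (basis u)) (?J j (basis v)))"
      unfolding conv_basis
    proof (intro sum.cong refl, clarify)
      fix u v assume "w = u @ v"
      then show "qshuffle br (fps_conv br a (basis u)) (fps_conv br b (basis v))
        = (\<Sum>i\<le>length (u @ v). \<Sum>j\<le>length (u @ v).
          (fps_nth a i * fps_nth b j) *\<^sub>R qshuffle br (?J i (basis u)) (?J j (basis v)))"
        by (subst sum.swap) (simp add: fps_conv_basis[of _ "length (u @ v)"] linear_sum[OF lin(1)]
            linear_sum[OF lin(2)] qshuffle_simps scaleR_sum_right mult.commute)
    qed
    also have "\<dots> = (\<Sum>i\<le>?N. \<Sum>j\<le>?N. (fps_nth a i * fps_nth b j) *\<^sub>R conv br (?J i) (?J j) (basis w))"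
      unfolding conv_basis scaleR_sum_right split_def
      by (subst sum.swap, rule sum.cong[OF refl], rule sum.swap)
    also have "\<dots> = (\<Sum>i\<le>?N. \<Sum>j\<le>?N. (fps_nth a i * fps_nth b j) *\<^sub>R ?J (i + j) (basis w))"
      by (simp add: conv_pow_add[OF assms])
    also have "\<dots> = (\<Sum>(i, j)\<in>{..?N} \<times> {..?N}. (fps_nth a i * fps_nth b j) *\<^sub>R ?J (i + j) (basis w))"
      by (simp add: sum.cartesian_product)
    \<comment> \<open>Outside the triangle the exponent \<open>i + j\<close> exceeds the length of
      \<open>w\<close>, so the power vanishes there.\<close>
    also have "\<dots> = (\<Sum>(i, j)\<in>{(i, j). i + j \<le> ?N}. (fps_nth a i * fps_nth b j) *\<^sub>R ?J (i + j) (basis w))"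
      using vanish by (intro sum.mono_neutral_right) auto
    also have "\<dots> = (\<Sum>k\<le>?N. \<Sum>i\<le>k. (fps_nth a i * fps_nth b (k - i)) *\<^sub>R ?J (i + (k - i)) (basis w))"
      by (rule sum.triangle_reindex_eq)
    also have "\<dots> = fps_conv br (a * b) (basis w)"
      by (simp add: fps_conv_basis[OF order_refl] fps_mult_nth scaleR_sum_left atLeast0AtMost)
    finally show "conv br (fps_conv br a) (fps_conv br b) (basis w) = fps_conv br (a * b) (basis w)" .
  qed
qed

lemma conv_pow_fps_conv:
  assumes "bilinear br" "\<And>x y z. br (br x y) z = br x (br y z)"
  shows "conv_pow br (fps_conv br a) k = fps_conv br (a ^ k)"
  by (induction k) (simp_all add: fps_conv_1 conv_pow_Suc fps_conv_mult[OF assms])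

lemma F_star_id_eq_fps_conv:
  assumes "fps_nth c 0 = 0"
  shows "F_star_id br c = fps_conv br c"
proof
  fix p show "F_star_id br c p = fps_conv br c p"
  proof (rule linear_eq_on_basis[OF _ linear_fps_conv])
    show "linear (F_star_id br c)"
      unfolding F_star_id_def by (rule linear_conv_series)
    fix w
    show "F_star_id br c (basis w) = fps_conv br c (basis w)"
      unfolding F_star_id_def fps_conv_basis[OF order_refl]
      by (subst conv_series_basis) (auto intro!: sum.mono_neutral_left simp: assms Suc_le_eq intro: gr0I)
  qed
qed

text \<open>The constant coefficient 1 turns the separate summand \<open>nu\<close> into the term
  for \<open>k = 0\<close>.\<close>

lemma F_inv_basis:
  assumes "X (basis []) = 0" "fps_nth b 0 = 1"
  shows "F_inv br b X (basis w) = (\<Sum>k\<le>length w. fps_nth b k *\<^sub>R conv_pow br X k (basis w))"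
proof -
  have "{..length w} = insert 0 {1..length w}" by auto
  then show ?thesis
    by (simp add: F_inv_def conv_series_basis assms del: nu_basis)
qed

lemma F_inv_F_star_id:
  assumes "bilinear br" "\<And>x y z. br (br x y) z = br x (br y z)"
    and inv: "inverse_series_at_1 c b"
  shows "F_inv br b (F_star_id br c) (basis w) = basis w"
proof -
  have c0: "fps_nth c 0 = 0" and b0: "fps_nth b 0 = 1" and comp: "fps_compose b c = 1 + fps_X"
    using inv by (auto simp: inverse_series_at_1_def)
  let ?N = "length w"
  \<comment> \<open>As \<open>c\<close> has no constant term, \<open>c ^ k\<close> starts in degree
    \<open>k\<close>; the bound \<open>?N\<close> thus gives the same sum as the bound
    \<open>m\<close> in the coefficient of the composition.\<close>
  have coeff: "(\<Sum>k\<le>?N. fps_nth b k * fps_nth (c ^ k) m) = fps_nth (1 + fps_X) m" if "m \<le> ?N" for m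
  proof -
    have "(\<Sum>k\<le>?N. fps_nth b k * fps_nth (c ^ k) m) = (\<Sum>k=0..m. fps_nth b k * fps_nth (c ^ k) m)"
      using that startsby_zero_power_prefix[OF c0]
      by (intro sum.mono_neutral_right) auto
    then show ?thesis
      by (simp add: comp[symmetric] fps_compose_nth)
  qed
  have "F_inv br b (F_star_id br c) (basis w)
      = (\<Sum>k\<le>?N. \<Sum>m\<le>?N. (fps_nth b k * fps_nth (c ^ k) m) *\<^sub>R conv_pow br JJ m (basis w))"
    by (simp add: F_star_id_eq_fps_conv c0 b0 F_inv_basis conv_pow_fps_conv[OF assms(1,2)]
        fps_conv_basis[OF order_refl] scaleR_sum_right)
  also have "\<dots> = (\<Sum>m\<le>?N. \<Sum>k\<le>?N. (fps_nth b k * fps_nth (c ^ k) m) *\<^sub>R conv_pow br JJ m (basis w))"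
    by (rule sum.swap)
  also have "\<dots> = (\<Sum>m\<le>?N. fps_nth (1 + fps_X) m *\<^sub>R conv_pow br JJ m (basis w))"
    by (simp add: scaleR_sum_left[symmetric] coeff)
  \<comment> \<open>The extra zero term puts index 1 in range even for the empty word.\<close>
  also have "\<dots> = (\<Sum>m\<le>Suc ?N. fps_nth (1 + fps_X) m *\<^sub>R conv_pow br JJ m (basis w))"
    by (simp add: conv_pow_eq_0)
  also have "\<dots> = (\<Sum>m\<in>{0, 1}. fps_nth (1 + fps_X) m *\<^sub>R conv_pow br JJ m (basis w))"
    by (intro sum.mono_neutral_right) auto
  \<comment> \<open>The two remaining terms are \<open>nu\<close> and \<open>JJ\<close>, whose sum
    is the identity.\<close>
  also have "\<dots> = basis w"
    by (simp add: conv_pow_1[OF linear_JJ, simplified])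
  finally show ?thesis .
qed

section \<open>Truncation\<close>

text \<open>A factorization \<open>u @ v = w\<close> contributes words of grade
  \<open>g u + g v\<close>, which is \<open>g w\<close> because the grading is additive under
  concatenation.\<close>

lemma keys_conv_pow_JJ_grade:
  assumes "preserved_by_qshuffle br g" "g [] = 0"
  shows "\<forall>v\<in>Poly_Mapping.keys (conv_pow br JJ k (basis w)). g v = g w"
proof (induction k arbitrary: w)
  case 0
  then show ?case using assms by simp
next
  case (Suc k)
  let ?S = "{p. Poly_Mapping.keys p \<subseteq> {v. g v = g w}}"
  have "qshuffle br (JJ (basis u)) (conv_pow br JJ k (basis v)) \<in> ?S" if "u @ v = w" for u v
  proof -
    have "\<forall>z\<in>Poly_Mapping.keys (qshuffle br (JJ (basis u)) (conv_pow br JJ k (basis v))). g z = g u + g v"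
      using Suc by (intro keys_qshuffle_grade[OF assms(1)]) auto
    then show ?thesis
      using preserved_by_qshuffle_append[OF assms(1), of u v] that by auto
  qed
  then have "conv_pow br JJ (Suc k) (basis w) \<in> ?S"
    unfolding conv_pow_Suc conv_basis by (intro subspace_sum subspace_keys_subset) auto
  then show ?case by auto
qed

lemma keys_fps_conv_grade:
  assumes "preserved_by_qshuffle br g" "g [] = 0"
  shows "\<forall>v\<in>Poly_Mapping.keys (fps_conv br a (basis w)). g v = g w"
proof -
  have "fps_conv br a (basis w) \<in> {p. Poly_Mapping.keys p \<subseteq> {v. g v = g w}}"
    unfolding fps_conv_basis[OF order_refl] using keys_conv_pow_JJ_grade[OF assms]
    by (intro subspace_sum subspace_scale subspace_keys_subset) auto
  then show ?thesis by auto
qed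

text \<open>Factors of a word of grade at most \<open>n\<close> again have grade at most
  \<open>n\<close>. In grade \<open>n + 1\<close> this still holds when both factors are nonempty,
  since each then has positive grade.\<close>

lemma conv_pow_truncate:
  assumes add: "\<And>u v. g (u @ v) = g u + g v" and pos: "\<And>w. w \<noteq> [] \<Longrightarrow> 0 < g w"
    and X: "X (basis []) = 0" "Y (basis []) = 0"
    and eq: "\<And>w. g w \<le> n \<Longrightarrow> Y (basis w) = X (basis w)"
  shows "g w \<le> n \<Longrightarrow> conv_pow br Y k (basis w) = conv_pow br X k (basis w)"
    and "g w \<le> Suc n \<Longrightarrow> k \<noteq> 1 \<Longrightarrow> conv_pow br Y k (basis w) = conv_pow br X k (basis w)"
proof -
  have zero: "qshuffle br 0 p = 0" "qshuffle br p 0 = 0" for p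
    by (simp_all add: bilinear_lzero[OF bilinear_qshuffle] bilinear_rzero[OF bilinear_qshuffle])
  have le: "conv_pow br Y k (basis w) = conv_pow br X k (basis w)" if "g w \<le> n" for k w
    using that
  proof (induction k arbitrary: w)
    case (Suc k)
    show ?case
      unfolding conv_pow_Suc
      by (rule conv_cong) (use Suc eq add in auto)
  qed simp
  show "g w \<le> n \<Longrightarrow> conv_pow br Y k (basis w) = conv_pow br X k (basis w)"
    by (rule le)
  show "conv_pow br Y k (basis w) = conv_pow br X k (basis w)" if "g w \<le> Suc n" "k \<noteq> 1"
  proof (cases k)
    case (Suc m)
    \<comment> \<open>This is where \<open>k \<noteq> 1\<close> enters: for \<open>v = []\<close>
      the factor \<open>conv_pow br _ m (basis v)\<close> vanishes only because \<open>m\<close> is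
      positive.\<close>
    then have m: "0 < m" using that by simp
    show ?thesis
      unfolding Suc conv_pow_Suc
    proof (rule conv_cong)
      fix u v assume uv: "u @ v = w"
      consider "u = []" | "v = []" | "u \<noteq> []" "v \<noteq> []" by blast
      then show "qshuffle br (Y (basis u)) (conv_pow br Y m (basis v))
        = qshuffle br (X (basis u)) (conv_pow br X m (basis v))"
      proof cases
        case 3
        then have "g u \<le> n" "g v \<le> n"
          using pos[of u] pos[of v] add[of u v] uv that by auto
        then show ?thesis by (simp add: eq le)
      qed (use X m zero in \<open>simp_all add: conv_pow_eq_0\<close>)
    qed
  qed simp
qed

theorem corollary1:
  fixes br :: "'a lcomb \<Rightarrow> 'a lcomb \<Rightarrow> 'a lcomb"
    and c b :: "real fps"
    and g :: "'a list \<Rightarrow> nat"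
    and n :: nat
  assumes "letter_bracket br"
    and "inverse_series_at_1 c b"
    and "grading g"
    and "preserved_by_qshuffle br g"
  shows "\<exists>E :: 'a ncpoly \<Rightarrow> 'a ncpoly. linear E
    \<and> (\<forall>w. g w \<le> n + 1 \<longrightarrow> E (basis w) = 0)
    \<and> F_inv br b (word_proj (\<lambda>w. g w \<le> n) \<circ> F_star_id br c)
      = (\<lambda>p. word_proj (\<lambda>w. g w \<le> n) p
           + word_proj (\<lambda>w. g w = n + 1) (JJ p - (1 / fps_nth c 1) *\<^sub>R F_star_id br c p)
           + E p)"
proof -
  have br: "bilinear br" "\<And>x y z. br (br x y) z = br x (br y z)"
    using assms(1) by (auto simp: letter_bracket_def)
  have g0: "g [] = 0" and pos: "\<And>w. w \<noteq> [] \<Longrightarrow> 0 < g w"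
    using assms(3) by (auto simp: grading_def)
  note add = preserved_by_qshuffle_append[OF assms(4)]
  have c0: "fps_nth c 0 = 0" and b0: "fps_nth b 0 = 1"
    using assms(2) by (auto simp: inverse_series_at_1_def)
  note b1 = inverse_series_at_1_nth_1(2)[OF assms(2)]
  define X where "X = F_star_id br c"
  define Y where "Y = word_proj (\<lambda>w. g w \<le> n) \<circ> X"
  define R where "R = (\<lambda>p. word_proj (\<lambda>w. g w \<le> n) p
      + word_proj (\<lambda>w. g w = n + 1) (JJ p - (1 / fps_nth c 1) *\<^sub>R X p))"
  \<comment> \<open>The error term is taken to be the difference of the two sides, so its vanishing
    up to grade \<open>n + 1\<close> is what remains to be shown.\<close>
  define E where "E = (\<lambda>p. F_inv br b Y p - R p)"
  have X_fps: "X = fps_conv br c"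
    by (simp add: X_def F_star_id_eq_fps_conv c0)
  have linX: "linear X"
    by (simp add: X_fps linear_fps_conv)
  have linY: "linear Y"
    unfolding Y_def by (intro linear_compose linX linear_word_proj)
  have X0: "X (basis []) = 0"
    by (simp add: X_fps fps_conv_basis[OF order_refl] c0)
  have grade: "\<forall>v\<in>Poly_Mapping.keys (X (basis w)). g v = g w" for w
    unfolding X_fps by (rule keys_fps_conv_grade[OF assms(4) g0])
  \<comment> \<open>By homogeneity the truncation keeps \<open>X (basis w)\<close> entirely or kills
    it entirely.\<close>
  have Y_le: "Y (basis w) = X (basis w)" if "g w \<le> n" for w
    unfolding Y_def o_def by (rule word_proj_id) (use grade that in auto)
  have Y_gt: "Y (basis w) = 0" if "\<not> g w \<le> n" for w
    unfolding Y_def o_def by (rule word_proj_zero) (use grade that in auto)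
  have Y0: "Y (basis []) = 0"
    using Y_le[of "[]"] g0 X0 by simp
  note trunc = conv_pow_truncate[where g = g and n = n and X = X and Y = Y, OF add pos X0 Y0 Y_le]
  have F_inv_X: "F_inv br b X (basis w) = basis w" for w
    unfolding X_def by (rule F_inv_F_star_id[OF br assms(2)])
  have linR: "linear R"
    unfolding R_def
    by (intro linear_compose_add linear_word_proj linear_compose_sub linear_JJ
        linear_compose_scale_right linX linear_compose[of _ "word_proj _", unfolded o_def])
  have linE: "linear E"
    unfolding E_def F_inv_def
    by (intro linear_compose_sub linear_compose_add linear_nu linear_conv_series linR)
  have "E (basis w) = 0" if "g w \<le> n + 1" for w
  proof (cases "g w \<le> n")
    case True
    \<comment> \<open>In grade at most \<open>n\<close> the truncation is invisible, so both
      \<open>F_inv br b Y\<close> and \<open>R\<close> return the word itself.\<close>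
    have "F_inv br b Y (basis w) = F_inv br b X (basis w)"
      by (simp add: F_inv_basis X0 Y0 b0 trunc(1)[OF _ _ True])
    moreover have "word_proj (\<lambda>w. g w = n + 1) (X (basis w)) = 0"
      by (rule word_proj_zero) (use grade True in auto)
    ultimately show ?thesis
      using True by (simp add: E_def R_def F_inv_X linear_diff[OF linear_word_proj]
          linear_scale[OF linear_word_proj] linear_0[OF linear_word_proj])
  next
    case False
    then have gw: "g w = n + 1" and w: "w \<noteq> []"
      using that g0 by auto
    \<comment> \<open>The linear term is isolated; index 1 is in range because \<open>w\<close> is
      nonempty.\<close>
    have split: "{..length w} = insert 1 ({..length w} - {1})"
      using w by (cases w) auto
    have sum_split: "F_inv br b Z (basis w) = fps_nth b 1 *\<^sub>R Z (basis w)
        + (\<Sum>k\<in>{..length w} - {1}. fps_nth b k *\<^sub>R conv_pow br Z k (basis w))"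
      if "Z (basis []) = 0" "linear Z" for Z
      unfolding F_inv_basis[where X = Z, OF that(1) b0]
      by (subst split, subst sum.insert) (simp_all add: conv_pow_1[OF that(2), simplified])
    \<comment> \<open>All terms with \<open>k \<noteq> 1\<close> agree for \<open>X\<close> and
      \<open>Y\<close>, while the linear term of \<open>Y\<close> is zero as \<open>g w\<close>
      exceeds \<open>n\<close>.\<close>
    have "F_inv br b X (basis w) = fps_nth b 1 *\<^sub>R X (basis w) + F_inv br b Y (basis w)"
      using gw by (simp add: sum_split X0 Y0 linX linY Y_gt[OF False] trunc(2))
    then have "F_inv br b Y (basis w) = basis w - (1 / fps_nth c 1) *\<^sub>R X (basis w)"
      unfolding F_inv_X b1 by (simp add: algebra_simps)
    moreover have "word_proj (\<lambda>w. g w = n + 1) (X (basis w)) = X (basis w)"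
      by (rule word_proj_id) (use grade gw in auto)
    ultimately show ?thesis
      using gw w by (simp add: E_def R_def linear_diff[OF linear_word_proj]
          linear_scale[OF linear_word_proj])
  qed
  moreover have "F_inv br b Y = (\<lambda>p. R p + E p)"
    by (simp add: E_def)
  ultimately show ?thesis
    using linE unfolding Y_def R_def X_def by blast
qed

end
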